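(* Let $\phi\in[0,1]$, let $B_0\in\mathbb{R}^{n\times n}$ be symmetric positive definite, let $(s_0,y_0),\dots,(s_k,y_k)$ be pairs of vectors in $\mathbb{R}^n$, and let $B_1,\dots,B_{k+1}$ be the matrices obtained from $B_0$ by successive restricted Broyden class updates with parameter $\phi$. Assume that all updates are well defined and that all $B_i$ are positive definite. Put $H_0=B_0^{-1}$ and $H_{k+1}=B_{k+1}^{-1}$. Then $$H_{k+1}=H_0+\tilde\Psi_k\tilde M_k\tilde\Psi_k^T,\qquad \tilde\Psi_k=\begin{bmatrix}S_k & H_0Y_k\end{bmatrix},$$ where $$\tilde M_k=\begin{bmatrix}-\phi\Lambda_k & -R_k-D_k-\phi\Lambda_k\\ -R_k^T-D_k-\phi\Lambda_k & -D_k-\phi\Lambda_k-Y_k^TH_0Y_k\end{bmatrix}^{-1}.$$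
   Context: Restricted Broyden class update with parameter $\phi\in[0,1]$: for $0\le i\le k$, $$B_{i+1}=B_i-\frac{1}{s_i^TB_is_i}B_is_is_i^TB_i+\frac{1}{y_i^Ts_i}y_iy_i^T+\phi(s_i^TB_is_i)w_iw_i^T,\qquad w_i=\frac{y_i}{y_i^Ts_i}-\frac{B_is_i}{s_i^TB_is_i}.$$ The same $\phi$ is used for every update. "All updates are well defined" means $s_i\neq 0$ and $y_i^Ts_i\ne0$ for $0\le i\le k$; positive definiteness means that $B_0,\dots,B_{k+1}$ are symmetric positive definite. Notation: $S_k=[s_0\ s_1\ \cdots\ s_k]\in\mathbb{R}^{n\times(k+1)}$, $Y_k=[y_0\ y_1\ \cdots\ y_k]\in\mathbb{R}^{n\times(k+1)}$. Write $S_k^TY_k=L_k+D_k+R_k$ with $L_k$ strictly lower triangular, $D_k$ diagonal and $R_k$ strictly upper triangular. Finally $\Lambda_k=\mathrm{diag}(\lambda_0,\dots,\lambda_k)$ with $$\lambda_i=\frac{1}{-\dfrac{1-\phi}{s_i^TB_is_i}-\dfrac{\phi}{s_i^Ty_i}},\qquad 0\le i\le k.$$ *)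

theory Defs
  imports
    Complex_Main
    "Jordan_Normal_Form.Determinant"
    "Jordan_Normal_Form.Gauss_Jordan_Elimination"
begin

definition sym_pos_def :: "nat \<Rightarrow> real mat \<Rightarrow> bool" where
  "sym_pos_def n A \<longleftrightarrow>
     A \<in> carrier_mat n n \<and> A\<^sup>T = A \<and>
     (\<forall>v \<in> carrier_vec n. v \<noteq> 0\<^sub>v n \<longrightarrow> v \<bullet> (A *\<^sub>v v) > 0)"

definition outer :: "real vec \<Rightarrow> real vec \<Rightarrow> real mat" where
  "outer u v = mat (dim_vec u) (dim_vec v) (\<lambda>(i, j). u $ i * v $ j)"

(* Meaningful only if mat_inverse A is not None, that is, if A is an invertible square matrix. *)
definition mat_inv :: "real mat \<Rightarrow> real mat" where
  "mat_inv A = the (mat_inverse A)"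

lemma mat_inv_eqI:
  assumes A: "A \<in> carrier_mat n n" and C: "C \<in> carrier_mat n n"
    and AC: "A * C = 1\<^sub>m n"
  shows "mat_inv A = C"
proof (cases "mat_inverse A")
  case None
  have "C * A = 1\<^sub>m n"
    using mat_mult_left_right_inverse[OF A C AC] .
  then have "A \<in> Units (ring_mat TYPE(real) n (undefined :: unit))"
    using A C AC by (auto simp: Units_def ring_mat_simps)
  with mat_inverse(1)[OF A None, of "undefined :: unit"] show ?thesis by blast
next
  case (Some D)
  have D: "D * A = 1\<^sub>m n" "D \<in> carrier_mat n n"
    using mat_inverse(2)[OF A Some] by auto
  have "D = D * (A * C)" using AC D by simp
  also have "\<dots> = (D * A) * C" by (rule assoc_mult_mat[OF D(2) A C, symmetric])
  also have "\<dots> = C" using C D by simp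
  finally show ?thesis using Some by (simp add: mat_inv_def)
qed

definition broyden_update :: "real \<Rightarrow> real mat \<Rightarrow> real vec \<Rightarrow> real vec \<Rightarrow> real mat" where
  "broyden_update \<phi> B s y =
     (let sBs = s \<bullet> (B *\<^sub>v s);
          w = (1 / (y \<bullet> s)) \<cdot>\<^sub>v y - (1 / sBs) \<cdot>\<^sub>v (B *\<^sub>v s)
      in B - (1 / sBs) \<cdot>\<^sub>m (B * outer s s * B)
           + (1 / (y \<bullet> s)) \<cdot>\<^sub>m outer y y
           + (\<phi> * sBs) \<cdot>\<^sub>m outer w w)"

definition columns_upto :: "nat \<Rightarrow> nat \<Rightarrow> (nat \<Rightarrow> real vec) \<Rightarrow> real mat" where
  "columns_upto n k v = mat_of_cols n (map v [0..<Suc k])"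

definition strict_lower_part :: "real mat \<Rightarrow> real mat" where
  "strict_lower_part A =
     mat (dim_row A) (dim_col A) (\<lambda>(i, j). if j < i then A $$ (i, j) else 0)"

definition diag_part :: "real mat \<Rightarrow> real mat" where
  "diag_part A =
     mat (dim_row A) (dim_col A) (\<lambda>(i, j). if i = j then A $$ (i, j) else 0)"

definition strict_upper_part :: "real mat \<Rightarrow> real mat" where
  "strict_upper_part A =
     mat (dim_row A) (dim_col A) (\<lambda>(i, j). if i < j then A $$ (i, j) else 0)"

lemma lower_diag_upper_decomposition:
  "A = strict_lower_part A + diag_part A + strict_upper_part A"
  by (rule eq_matI) (auto simp: strict_lower_part_def diag_part_def strict_upper_part_def)

definition broyden_lambda :: "real \<Rightarrow> real mat \<Rightarrow> real vec \<Rightarrow> real vec \<Rightarrow> real" where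
  "broyden_lambda \<phi> B s y =
     1 / (- ((1 - \<phi>) / (s \<bullet> (B *\<^sub>v s))) - \<phi> / (s \<bullet> y))"

definition append_columns :: "real mat \<Rightarrow> real mat \<Rightarrow> real mat" where
  "append_columns A B = four_block_mat A B (0\<^sub>m 0 (dim_col A)) (0\<^sub>m 0 (dim_col B))"

end

theory Submission
  imports Defs
begin

text \<open>
  Let \<open>M\<close> denote the block matrix whose inverse is the middle factor of the compact form. The
  proof reads a solution \<open>(a, b)\<close> of the linear system \<open>M (a, b) = \<Psi>\<^sup>T v\<close> as a path along the
  updates. Put
  \<open>u\<^sub>i = v + (\<Sum>j\<ge>i. b\<^sub>j y\<^sub>j)\<close> and \<open>x\<^sub>i = H\<^sub>0 u\<^sub>0 + (\<Sum>j<i. a\<^sub>j s\<^sub>j)\<close>.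
  The upper triangle in the top right block of \<open>M\<close> produces the tail sum in \<open>u\<^sub>i\<close>, the transposed
  triangle in the bottom left block produces the initial sum in \<open>x\<^sub>i\<close>. So the two rows of the
  system with index \<open>i\<close> involve only \<open>u\<^sub>i\<close>, \<open>x\<^sub>i\<close>, \<open>a\<^sub>i\<close> and \<open>b\<^sub>i\<close>: they become
  \<open>s\<^sub>i\<^sup>T u\<^sub>i = - \<phi> \<lambda>\<^sub>i (a\<^sub>i + b\<^sub>i)\<close> and
  \<open>y\<^sub>i\<^sup>T x\<^sub>i + a\<^sub>i s\<^sub>i\<^sup>T y\<^sub>i = - \<phi> \<lambda>\<^sub>i (a\<^sub>i + b\<^sub>i) - b\<^sub>i s\<^sub>i\<^sup>T y\<^sub>i\<close>
  (lemma \<open>chain_of_solution\<close>).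

  These are exactly the two scalar conditions under which one update carries \<open>B\<^sub>i x\<^sub>i = u\<^sub>i\<close> to
  \<open>B\<^sub>i\<^sub>+\<^sub>1 x\<^sub>i\<^sub>+\<^sub>1 = u\<^sub>i\<^sub>+\<^sub>1\<close> (lemma \<open>broyden_update_step\<close>). Since \<open>B\<^sub>0 x\<^sub>0 = u\<^sub>0\<close> by the choice of
  \<open>x\<^sub>0\<close>, the end of the path is \<open>B\<^sub>k\<^sub>+\<^sub>1 (H\<^sub>0 v + \<Psi> (a, b)) = v\<close>. Once \<open>M\<close> is invertible, this says
  that \<open>H\<^sub>0 + \<Psi> M\<^sup>-\<^sup>1 \<Psi>\<^sup>T\<close> is a right inverse of \<open>B\<^sub>k\<^sub>+\<^sub>1\<close>.

  Invertibility of \<open>M\<close> comes from walking the path for \<open>v = 0\<close> backwards. If \<open>u\<^sub>i\<^sub>+\<^sub>1 = 0\<close>, positive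
  definiteness gives \<open>x\<^sub>i\<^sub>+\<^sub>1 = 0\<close>, and then the first condition forces \<open>a\<^sub>i = b\<^sub>i = 0\<close>, because
  eliminating \<open>b\<^sub>i\<close> leaves \<open>a\<^sub>i\<close> with the coefficient \<open>1\<close> (lemma \<open>broyden_update_step_trivial\<close>). Hence \<open>u\<^sub>i = 0\<close>
  and the argument repeats, so that the kernel of \<open>M\<close> is trivial.
\<close>

section \<open>Inverses and symmetric positive definite matrices\<close>

lemma mat_inv_of_trivial_kernel:
  assumes A: "A \<in> carrier_mat n n"
    and inj: "\<And>v. v \<in> carrier_vec n \<Longrightarrow> A *\<^sub>v v = 0\<^sub>v n \<Longrightarrow> v = 0\<^sub>v n"
  shows "mat_inv A \<in> carrier_mat n n" "A * mat_inv A = 1\<^sub>m n" "mat_inv A * A = 1\<^sub>m n"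
proof -
  have "det A \<noteq> 0"
    using det_0_iff_vec_prod_zero[OF A] inj by blast
  from det_non_zero_imp_unit[OF A this, of "undefined :: unit"]
  obtain C where C: "mat_inverse A = Some C"
    using mat_inverse(1)[OF A, of "undefined :: unit"] by (cases "mat_inverse A") auto
  from mat_inverse(2)[OF A C] C
  show "mat_inv A \<in> carrier_mat n n" "A * mat_inv A = 1\<^sub>m n" "mat_inv A * A = 1\<^sub>m n"
    by (auto simp: mat_inv_def)
qed

lemma sym_pos_def_kernel:
  assumes "sym_pos_def n A" "v \<in> carrier_vec n" "A *\<^sub>v v = 0\<^sub>v n"
  shows "v = 0\<^sub>v n"
proof (rule ccontr)
  assume "v \<noteq> 0\<^sub>v n"
  then have "v \<bullet> (A *\<^sub>v v) > 0" using assms(1,2) by (auto simp: sym_pos_def_def)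
  then show False using assms(2,3) by simp
qed

lemma sym_scalar_prod:
  fixes A :: "real mat"
  assumes "A \<in> carrier_mat n n" "A\<^sup>T = A" "u \<in> carrier_vec n" "v \<in> carrier_vec n"
  shows "(A *\<^sub>v u) \<bullet> v = u \<bullet> (A *\<^sub>v v)"
  using transpose_vec_mult_scalar[OF assms(1,4,3)] assms(2) by simp

lemma mat_eq_one_if_fixes_vecs:
  fixes A :: "real mat"
  assumes A: "A \<in> carrier_mat n n" and fixes_all: "\<And>v. v \<in> carrier_vec n \<Longrightarrow> A *\<^sub>v v = v"
  shows "A = 1\<^sub>m n"
proof (rule eq_matI)
  fix i j assume ij: "i < dim_row (1\<^sub>m n :: real mat)" "j < dim_col (1\<^sub>m n :: real mat)"
  have "A $$ (i, j) = (A *\<^sub>v unit_vec n j) $ i"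
    using A ij by (simp add: scalar_prod_right_unit)
  then show "A $$ (i, j) = 1\<^sub>m n $$ (i, j)"
    using fixes_all[of "unit_vec n j"] ij by simp
qed (use A in auto)

section \<open>One update\<close>

lemma outer_mult_vec:
  assumes "dim_vec v = dim_vec x"
  shows "outer u v *\<^sub>v x = (v \<bullet> x) \<cdot>\<^sub>v u"
  using assms
  by (intro eq_vecI) (auto simp: outer_def scalar_prod_def sum_distrib_left ac_simps intro!: sum.cong)

lemma broyden_update_mult_vec:
  fixes B :: "real mat"
  assumes B: "B \<in> carrier_mat n n" "B\<^sup>T = B"
    and s: "s \<in> carrier_vec n" and y: "y \<in> carrier_vec n" and x: "x \<in> carrier_vec n"
    and r: "r < n"
  shows "(broyden_update \<phi> B s y *\<^sub>v x) $ r =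
    (B *\<^sub>v x) $ r - (s \<bullet> (B *\<^sub>v x)) / (s \<bullet> (B *\<^sub>v s)) * (B *\<^sub>v s) $ r
    + (y \<bullet> x) / (y \<bullet> s) * y $ r
    + \<phi> * (s \<bullet> (B *\<^sub>v s)) * ((y \<bullet> x) / (y \<bullet> s) - (s \<bullet> (B *\<^sub>v x)) / (s \<bullet> (B *\<^sub>v s)))
      * (y $ r / (y \<bullet> s) - (B *\<^sub>v s) $ r / (s \<bullet> (B *\<^sub>v s)))"
proof -
  define w where "w = (1 / (y \<bullet> s)) \<cdot>\<^sub>v y - (1 / (s \<bullet> (B *\<^sub>v s))) \<cdot>\<^sub>v (B *\<^sub>v s)"
  have Bs: "B *\<^sub>v s \<in> carrier_vec n" and Bx: "B *\<^sub>v x \<in> carrier_vec n"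
    using mult_mat_vec_carrier[OF B(1)] s x by blast+
  have w: "w \<in> carrier_vec n" using y Bs by (auto simp: w_def)
  have oss: "outer s s \<in> carrier_mat n n" and oyy: "outer y y \<in> carrier_mat n n"
    and oww: "outer w w \<in> carrier_mat n n" using s y w by (auto simp: outer_def)
  have "(B * outer s s * B) *\<^sub>v x = B *\<^sub>v (outer s s *\<^sub>v (B *\<^sub>v x))"
    using assoc_mult_mat_vec[OF mult_carrier_mat[OF B(1) oss] B(1) x]
      assoc_mult_mat_vec[OF B(1) oss Bx] by simp
  also have "\<dots> = (s \<bullet> (B *\<^sub>v x)) \<cdot>\<^sub>v (B *\<^sub>v s)"
    using s Bx B(1) by (simp add: outer_mult_vec mult_mat_vec[OF B(1) s])
  finally have BssB: "(B * outer s s * B) *\<^sub>v x = (s \<bullet> (B *\<^sub>v x)) \<cdot>\<^sub>v (B *\<^sub>v s)" .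
  have wx: "w \<bullet> x = (y \<bullet> x) / (y \<bullet> s) - (s \<bullet> (B *\<^sub>v x)) / (s \<bullet> (B *\<^sub>v s))"
    using y Bs x sym_scalar_prod[OF B s x]
    by (simp add: w_def minus_scalar_prod_distrib[of _ n])
  have smult: "(c \<cdot>\<^sub>m M *\<^sub>v x) $ r = c * (M *\<^sub>v x) $ r" if "M \<in> carrier_mat n n" for c and M :: "real mat"
    using that r x by simp
  have split: "(broyden_update \<phi> B s y *\<^sub>v x) $ r =
      (B *\<^sub>v x) $ r - 1 / (s \<bullet> (B *\<^sub>v s)) * ((B * outer s s * B) *\<^sub>v x) $ r
      + 1 / (y \<bullet> s) * (outer y y *\<^sub>v x) $ r
      + \<phi> * (s \<bullet> (B *\<^sub>v s)) * (outer w w *\<^sub>v x) $ r"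
  proof -
    let ?a = "s \<bullet> (B *\<^sub>v s)"
    let ?M1 = "(1 / ?a) \<cdot>\<^sub>m (B * outer s s * B)" and ?M2 = "(1 / (y \<bullet> s)) \<cdot>\<^sub>m outer y y"
      and ?M3 = "(\<phi> * ?a) \<cdot>\<^sub>m outer w w"
    have M: "?M1 \<in> carrier_mat n n" "?M2 \<in> carrier_mat n n" "?M3 \<in> carrier_mat n n"
      using B oss oyy oww by auto
    have "broyden_update \<phi> B s y = B - ?M1 + ?M2 + ?M3"
      by (simp add: broyden_update_def w_def Let_def)
    then have "broyden_update \<phi> B s y *\<^sub>v x = (B *\<^sub>v x - ?M1 *\<^sub>v x) + ?M2 *\<^sub>v x + ?M3 *\<^sub>v x"
      using add_mult_distrib_mat_vec[of "B - ?M1 + ?M2" n n ?M3 x]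
        add_mult_distrib_mat_vec[of "B - ?M1" n n ?M2 x]
        minus_mult_distrib_mat_vec[OF B(1) M(1) x] minus_carrier_mat[OF M(1), of B] M B(1) x
      by simp
    then have "(broyden_update \<phi> B s y *\<^sub>v x) $ r =
        (B *\<^sub>v x) $ r - (?M1 *\<^sub>v x) $ r + (?M2 *\<^sub>v x) $ r + (?M3 *\<^sub>v x) $ r"
      using r M B(1) x s y w by (simp add: outer_def)
    moreover have "(?M1 *\<^sub>v x) $ r = 1 / ?a * ((B * outer s s * B) *\<^sub>v x) $ r"
      by (rule smult) (use B oss in auto)
    moreover have "(?M2 *\<^sub>v x) $ r = 1 / (y \<bullet> s) * (outer y y *\<^sub>v x) $ r" by (rule smult[OF oyy])
    moreover have "(?M3 *\<^sub>v x) $ r = (\<phi> * ?a) * (outer w w *\<^sub>v x) $ r" by (rule smult[OF oww])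
    ultimately show ?thesis by simp
  qed
  have wr: "w $ r = y $ r / (y \<bullet> s) - (B *\<^sub>v s) $ r / (s \<bullet> (B *\<^sub>v s))"
    using r y Bs B by (simp add: w_def)
  have t1: "((B * outer s s * B) *\<^sub>v x) $ r = (s \<bullet> (B *\<^sub>v x)) * (B *\<^sub>v s) $ r"
    unfolding BssB using r B by simp
  have t2: "(outer y y *\<^sub>v x) $ r = (y \<bullet> x) * y $ r"
    using r y x by (simp add: outer_mult_vec)
  have t3: "(outer w w *\<^sub>v x) $ r = (w \<bullet> x) * w $ r"
    using r w x by (simp add: outer_mult_vec)
  show ?thesis unfolding split t1 t2 t3 wx unfolding wr by simp
qed

lemma broyden_update_secant:
  assumes B: "sym_pos_def n B" and s: "s \<in> carrier_vec n" and y: "y \<in> carrier_vec n"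
    and s0: "s \<noteq> 0\<^sub>v n" and d: "y \<bullet> s \<noteq> 0"
  shows "broyden_update \<phi> B s y *\<^sub>v s = y"
proof (rule eq_vecI)
  have a: "s \<bullet> (B *\<^sub>v s) > 0" using B s s0 by (auto simp: sym_pos_def_def)
  fix r assume "r < dim_vec y"
  then have r: "r < n" using y by simp
  show "(broyden_update \<phi> B s y *\<^sub>v s) $ r = y $ r"
    using broyden_update_mult_vec[of B n s y s r \<phi>] B s y r a d by (simp add: sym_pos_def_def)
qed (use B y in \<open>auto simp: broyden_update_def Let_def outer_def sym_pos_def_def\<close>)

text \<open>By the secant equation the curvature \<open>s\<^sup>T y\<close> is the value at \<open>s\<close> of the quadratic form of the
  updated matrix.\<close>

lemma curvature_positive:
  assumes B: "sym_pos_def n B" and s: "s \<in> carrier_vec n" and y: "y \<in> carrier_vec n"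
    and s0: "s \<noteq> 0\<^sub>v n" and d: "y \<bullet> s \<noteq> 0"
    and B': "sym_pos_def n (broyden_update \<phi> B s y)"
  shows "s \<bullet> y > 0"
  using B' s s0 broyden_update_secant[OF B s y s0 d, of \<phi>] by (auto simp: sym_pos_def_def)

text \<open>Both summands of \<open>p\<close> are nonnegative and they never vanish together, so every division by
  zero is excluded on the whole interval of \<open>\<phi>\<close>, its two ends included.\<close>

lemma broyden_lambda_eq:
  assumes \<alpha>: "s \<bullet> (B *\<^sub>v s) > 0" and \<delta>: "s \<bullet> y > 0" and \<phi>: "0 \<le> \<phi>" "\<phi> \<le> 1"
  defines "p \<equiv> (1 - \<phi>) / (s \<bullet> (B *\<^sub>v s)) + \<phi> / (s \<bullet> y)"
  shows "p > 0" "broyden_lambda \<phi> B s y = - 1 / p"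
proof -
  show "p > 0"
  proof (cases "\<phi> = 0")
    case True then show ?thesis using \<alpha> by (simp add: p_def)
  next
    case False
    then have "\<phi> / (s \<bullet> y) > 0" using \<phi> \<delta> by simp
    moreover have "(1 - \<phi>) / (s \<bullet> (B *\<^sub>v s)) \<ge> 0" using \<phi> \<alpha> by simp
    ultimately show ?thesis by (simp add: p_def)
  qed
  show "broyden_lambda \<phi> B s y = - 1 / p"
    unfolding broyden_lambda_def p_def
    by (metis diff_conv_add_uminus minus_add_distrib minus_divide_left minus_divide_right)
qed

text \<open>
  With \<open>\<sigma> = s\<^sup>T B x\<close>, \<open>\<alpha> = s\<^sup>T B s\<close> and \<open>\<delta> = s\<^sup>T y\<close>, the secant equation accounts for the term
  \<open>a s\<close>, and expanding the update at \<open>x\<close> leaves the vector \<open>u\<close> plus a multiple of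
  \<open>w = y/\<delta> - B s/\<alpha>\<close>. The definition of \<open>\<lambda>\<close> is what makes this multiple vanish.
\<close>

lemma broyden_update_step:
  assumes B: "sym_pos_def n B" and s: "s \<in> carrier_vec n" and y: "y \<in> carrier_vec n"
    and s0: "s \<noteq> 0\<^sub>v n" and d: "s \<bullet> y > 0" and \<phi>: "0 \<le> \<phi>" "\<phi> \<le> 1"
    and x: "x \<in> carrier_vec n" and u: "u \<in> carrier_vec n"
    and Bx: "B *\<^sub>v x = u + b \<cdot>\<^sub>v y"
    and row1: "s \<bullet> (u + b \<cdot>\<^sub>v y) = - \<phi> * broyden_lambda \<phi> B s y * (a + b)"
    and row2: "y \<bullet> x + a * (s \<bullet> y) = - \<phi> * broyden_lambda \<phi> B s y * (a + b) - b * (s \<bullet> y)"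
  shows "broyden_update \<phi> B s y *\<^sub>v (x + a \<cdot>\<^sub>v s) = u"
proof (rule eq_vecI)
  fix r assume "r < dim_vec u"
  then have r: "r < n" using u by simp
  define \<alpha> where "\<alpha> = s \<bullet> (B *\<^sub>v s)"
  define \<delta> where "\<delta> = s \<bullet> y"
  define \<sigma> where "\<sigma> = s \<bullet> (u + b \<cdot>\<^sub>v y)"
  define p where "p = (1 - \<phi>) / \<alpha> + \<phi> / \<delta>"
  have Bc: "B \<in> carrier_mat n n" "B\<^sup>T = B" using B by (auto simp: sym_pos_def_def)
  have \<alpha>: "\<alpha> > 0" using B s s0 by (auto simp: sym_pos_def_def \<alpha>_def)
  have \<delta>: "\<delta> > 0" using d by (simp add: \<delta>_def)
  have ys: "y \<bullet> s = \<delta>" using comm_scalar_prod[OF s y] by (simp add: \<delta>_def)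
  have p: "p > 0" and lam: "broyden_lambda \<phi> B s y = - 1 / p"
    using broyden_lambda_eq[of s B y \<phi>] \<phi> \<alpha> \<delta> by (simp_all add: p_def \<alpha>_def \<delta>_def)
  have \<sigma>: "\<sigma> * p = \<phi> * (a + b)" using row1 p by (simp add: \<sigma>_def[symmetric] lam)
  have yx: "y \<bullet> x + a * \<delta> = \<sigma> - b * \<delta>" using row1 row2 by (simp add: \<sigma>_def \<delta>_def)
  let ?z = "x + a \<cdot>\<^sub>v s"
  have z: "?z \<in> carrier_vec n" using x s by simp
  have Bs: "B *\<^sub>v s \<in> carrier_vec n" using mult_mat_vec_carrier[OF Bc(1) s] .
  have Bz: "B *\<^sub>v ?z = (u + b \<cdot>\<^sub>v y) + a \<cdot>\<^sub>v (B *\<^sub>v s)"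
    using mult_add_distrib_mat_vec[OF Bc(1) x, of "a \<cdot>\<^sub>v s"] mult_mat_vec[OF Bc(1) s] s Bx by simp
  have sBz: "s \<bullet> (B *\<^sub>v ?z) = \<sigma> + a * \<alpha>"
    unfolding Bz using scalar_prod_add_distrib[OF s, of "u + b \<cdot>\<^sub>v y" "a \<cdot>\<^sub>v (B *\<^sub>v s)"] u y s Bs
    by (simp add: \<sigma>_def \<alpha>_def)
  have yz: "y \<bullet> ?z = \<sigma> - b * \<delta>"
    using scalar_prod_add_distrib[OF y x, of "a \<cdot>\<^sub>v s"] s y ys yx by simp
  have Bzr: "(B *\<^sub>v ?z) $ r = u $ r + b * y $ r + a * (B *\<^sub>v s) $ r"
    unfolding Bz using r u y Bs Bc by simp
  define Y S where "Y = y $ r" and "S = (B *\<^sub>v s) $ r"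
  \<comment> \<open>The coefficient of \<open>w\<close> is \<open>\<alpha> (\<sigma> p - \<phi> (a + b))\<close>, and \<open>\<lambda> = -1/p\<close>.\<close>
  have key: "\<sigma> + \<phi> * \<alpha> * (\<sigma> / \<delta> - \<sigma> / \<alpha> - (a + b)) = 0"
  proof -
    have "\<sigma> * (\<alpha> * p) = \<alpha> * (\<phi> * (a + b))" using \<sigma> by (simp add: ac_simps)
    moreover have "\<alpha> * p = (1 - \<phi>) + \<phi> * \<alpha> / \<delta>" using \<alpha> by (simp add: p_def field_simps)
    ultimately show ?thesis using \<alpha> by (simp add: algebra_simps)
  qed
  have "(broyden_update \<phi> B s y *\<^sub>v ?z) $ r =
      (u $ r + b * Y + a * S) - (\<sigma> + a * \<alpha>) / \<alpha> * S + (\<sigma> - b * \<delta>) / \<delta> * Y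
      + \<phi> * \<alpha> * ((\<sigma> - b * \<delta>) / \<delta> - (\<sigma> + a * \<alpha>) / \<alpha>) * (Y / \<delta> - S / \<alpha>)"
    unfolding broyden_update_mult_vec[OF Bc s y z r] sBz yz Bzr ys \<alpha>_def[symmetric]
      Y_def[symmetric] S_def[symmetric] ..
  also have "\<dots> = u $ r + (\<sigma> + \<phi> * \<alpha> * (\<sigma> / \<delta> - \<sigma> / \<alpha> - (a + b))) * (Y / \<delta> - S / \<alpha>)"
  proof -
    have e: "(\<sigma> + a * \<alpha>) / \<alpha> = \<sigma> / \<alpha> + a" "(\<sigma> - b * \<delta>) / \<delta> = \<sigma> / \<delta> - b"
      using \<alpha> \<delta> by (simp_all add: field_simps)
    show ?thesis unfolding e by (simp add: algebra_simps)
  qed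
  finally show "(broyden_update \<phi> B s y *\<^sub>v ?z) $ r = u $ r" using key by simp
qed (use B u in \<open>auto simp: broyden_update_def Let_def outer_def sym_pos_def_def\<close>)

text \<open>
  Here \<open>x = - a s\<close>, so the equation for \<open>B x\<close> gives \<open>b \<delta> = - a \<alpha>\<close>. Eliminating \<open>b\<close> from the
  remaining condition yields \<open>a (\<alpha> p + \<phi> - \<phi> \<alpha>/\<delta>) = 0\<close>, and the bracket equals \<open>1\<close> whatever
  \<open>\<phi>\<close> is.
\<close>

lemma broyden_update_step_trivial:
  assumes B: "sym_pos_def n B" and s: "s \<in> carrier_vec n" and y: "y \<in> carrier_vec n"
    and s0: "s \<noteq> 0\<^sub>v n" and d: "s \<bullet> y > 0" and \<phi>: "0 \<le> \<phi>" "\<phi> \<le> 1"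
    and x: "x \<in> carrier_vec n"
    and xs: "x + a \<cdot>\<^sub>v s = 0\<^sub>v n" and Bx: "B *\<^sub>v x = b \<cdot>\<^sub>v y"
    and row1: "s \<bullet> (b \<cdot>\<^sub>v y) = - \<phi> * broyden_lambda \<phi> B s y * (a + b)"
  shows "a = 0" "b = 0"
proof -
  define \<alpha> where "\<alpha> = s \<bullet> (B *\<^sub>v s)"
  define \<delta> where "\<delta> = s \<bullet> y"
  define p where "p = (1 - \<phi>) / \<alpha> + \<phi> / \<delta>"
  have Bc: "B \<in> carrier_mat n n" using B by (auto simp: sym_pos_def_def)
  have \<alpha>: "\<alpha> > 0" using B s s0 by (auto simp: sym_pos_def_def \<alpha>_def)
  have \<delta>: "\<delta> > 0" using d by (simp add: \<delta>_def)
  have p: "p > 0" and lam: "broyden_lambda \<phi> B s y = - 1 / p"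
    using broyden_lambda_eq[of s B y \<phi>] \<phi> \<alpha> \<delta> by (simp_all add: p_def \<alpha>_def \<delta>_def)
  have "0\<^sub>v n = B *\<^sub>v (x + a \<cdot>\<^sub>v s)" using xs Bc by (auto intro!: eq_vecI)
  also have "\<dots> = b \<cdot>\<^sub>v y + a \<cdot>\<^sub>v (B *\<^sub>v s)"
    using mult_add_distrib_mat_vec[OF Bc x, of "a \<cdot>\<^sub>v s"] mult_mat_vec[OF Bc s] s Bx by simp
  finally have "s \<bullet> (b \<cdot>\<^sub>v y + a \<cdot>\<^sub>v (B *\<^sub>v s)) = 0" using s by (metis scalar_prod_right_zero)
  moreover have "s \<bullet> (b \<cdot>\<^sub>v y + a \<cdot>\<^sub>v (B *\<^sub>v s)) = b * \<delta> + a * \<alpha>"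
    using scalar_prod_add_distrib[OF s, of "b \<cdot>\<^sub>v y" "a \<cdot>\<^sub>v (B *\<^sub>v s)"] s y Bc
    by (simp add: \<alpha>_def \<delta>_def)
  ultimately have e1: "b * \<delta> = - a * \<alpha>" by simp
  have e2: "b * \<delta> * p = \<phi> * (a + b)" using row1 p s y by (simp add: lam \<delta>_def)
  have "a * \<alpha> * p = - \<phi> * a + a * \<alpha> / \<delta> * \<phi>"
  proof -
    have b: "b = - a * \<alpha> / \<delta>" using e1 \<delta> by (simp add: field_simps)
    show ?thesis using e2 \<delta> unfolding b by (simp add: algebra_simps)
  qed
  moreover have "a * \<alpha> * p = a * (1 - \<phi>) + a * \<alpha> / \<delta> * \<phi>"
    using \<alpha> by (simp add: p_def field_simps)
  ultimately show "a = 0" by (simp add: algebra_simps)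
  then show "b = 0" using e1 \<delta> by simp
qed

section \<open>Vectors carried through all updates\<close>

locale broyden_sequence =
  fixes n k :: nat and \<phi> :: real
    and B :: "nat \<Rightarrow> real mat" and s y :: "nat \<Rightarrow> real vec"
  assumes phi: "0 \<le> \<phi>" "\<phi> \<le> 1"
    and s: "\<And>i. i \<le> k \<Longrightarrow> s i \<in> carrier_vec n"
    and y: "\<And>i. i \<le> k \<Longrightarrow> y i \<in> carrier_vec n"
    and update: "\<And>i. i \<le> k \<Longrightarrow> B (Suc i) = broyden_update \<phi> (B i) (s i) (y i)"
    and s_nonzero: "\<And>i. i \<le> k \<Longrightarrow> s i \<noteq> 0\<^sub>v n"
    and ys_nonzero: "\<And>i. i \<le> k \<Longrightarrow> y i \<bullet> s i \<noteq> 0"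
    and pos_def: "\<And>i. i \<le> Suc k \<Longrightarrow> sym_pos_def n (B i)"
begin

abbreviation lam :: "nat \<Rightarrow> real" where
  "lam i \<equiv> broyden_lambda \<phi> (B i) (s i) (y i)"

lemma sy_pos: "i \<le> k \<Longrightarrow> s i \<bullet> y i > 0"
  using curvature_positive[of n "B i" "s i" "y i" \<phi>] pos_def[of i] pos_def[of "Suc i"]
    s y s_nonzero ys_nonzero update by simp

text \<open>The two scalar equations are the rows with index \<open>i\<close> of the block system, written in terms of
  the current pair \<open>(x i, u i)\<close> alone. The vectors \<open>x\<close> accumulate forwards and the vectors \<open>u\<close> lose
  one summand at each step.\<close>

definition chain :: "(nat \<Rightarrow> real) \<Rightarrow> (nat \<Rightarrow> real) \<Rightarrow> (nat \<Rightarrow> real vec) \<Rightarrow> (nat \<Rightarrow> real vec) \<Rightarrow> bool" where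
  "chain a b x u \<longleftrightarrow>
     (\<forall>i \<le> Suc k. x i \<in> carrier_vec n \<and> u i \<in> carrier_vec n) \<and> B 0 *\<^sub>v x 0 = u 0 \<and>
     (\<forall>i \<le> k. x (Suc i) = x i + a i \<cdot>\<^sub>v s i \<and> u i = u (Suc i) + b i \<cdot>\<^sub>v y i \<and>
        s i \<bullet> u i = - \<phi> * lam i * (a i + b i) \<and>
        y i \<bullet> x i + a i * (s i \<bullet> y i) = - \<phi> * lam i * (a i + b i) - b i * (s i \<bullet> y i))"

lemma chainD:
  assumes "chain a b x u" and "i \<le> k"
  shows "x (Suc i) = x i + a i \<cdot>\<^sub>v s i" "u i = u (Suc i) + b i \<cdot>\<^sub>v y i"
    "s i \<bullet> u i = - \<phi> * lam i * (a i + b i)"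
    "y i \<bullet> x i + a i * (s i \<bullet> y i) = - \<phi> * lam i * (a i + b i) - b i * (s i \<bullet> y i)"
    "x i \<in> carrier_vec n" "x (Suc i) \<in> carrier_vec n" "u (Suc i) \<in> carrier_vec n"
  using assms le_SucI[of i k] Suc_le_mono[of i k] unfolding chain_def by blast+

lemma chain_transport:
  assumes c: "chain a b x u" and "i \<le> Suc k"
  shows "B i *\<^sub>v x i = u i"
  using assms(2)
proof (induction i)
  case 0
  then show ?case using c by (simp add: chain_def)
next
  case (Suc i)
  then have i: "i \<le> k" by simp
  note e = chainD[OF c i]
  show ?case unfolding update[OF i] e(1)
  proof (rule broyden_update_step)
    show "B i *\<^sub>v x i = u (Suc i) + b i \<cdot>\<^sub>v y i" using Suc.IH i e(2) by simp
    show "s i \<bullet> (u (Suc i) + b i \<cdot>\<^sub>v y i) = - \<phi> * lam i * (a i + b i)" using e(2,3) by simp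
  qed (use e(4-) pos_def s y s_nonzero sy_pos phi i in auto)
qed

text \<open>Backward induction: \<open>u (Suc i) = 0\<close> forces \<open>x (Suc i) = 0\<close> by definiteness of \<open>B (Suc i)\<close>,
  then \<open>a i = b i = 0\<close>, and therefore \<open>u i = u (Suc i) = 0\<close>.\<close>

lemma chain_trivial:
  assumes c: "chain a b x u" and u0: "u (Suc k) = 0\<^sub>v n" and "i \<le> k"
  shows "a i = 0 \<and> b i = 0"
proof -
  have coeffs_zero: "a i = 0 \<and> b i = 0" if i: "i \<le> k" and ui: "u (Suc i) = 0\<^sub>v n" for i
  proof -
    note e = chainD[OF c i]
    have ub: "u i = b i \<cdot>\<^sub>v y i" using e(2) ui y[OF i] by simp
    have x_next: "x (Suc i) = 0\<^sub>v n"
      using sym_pos_def_kernel[OF pos_def, of "Suc i"] chain_transport[OF c, of "Suc i"] i e(6) ui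
      by simp
    have Bx: "B i *\<^sub>v x i = b i \<cdot>\<^sub>v y i"
      using chain_transport[OF c, of i] i ub by simp
    have "sym_pos_def n (B i)" using pos_def i by simp
    from broyden_update_step_trivial[OF this s[OF i] y[OF i] s_nonzero[OF i] sy_pos[OF i] phi e(5)
        x_next[unfolded e(1)] Bx e(3)[unfolded ub]]
    show ?thesis by simp
  qed
  have "u (Suc i) = 0\<^sub>v n" if "i \<le> k" for i
    using that
  proof (induction i rule: inc_induct)
    case base
    show ?case by (rule u0)
  next
    case (step i)
    then have "Suc i \<le> k" by simp
    from coeffs_zero[OF this step.IH] chainD(2)[OF c this] step.IH y[OF this] show ?case
      by (auto intro!: eq_vecI)
  qed
  with coeffs_zero assms(3) show ?thesis by blast
qed

end

section \<open>Block matrices acting on vectors\<close>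

text \<open>Multiplying by the triangular blocks turns a row into a tail sum (upper part) or an initial sum
  (transposed upper part) that includes the diagonal term; this is where the order of the updates
  enters the block matrix.\<close>

lemma upper_part_mult_vec:
  assumes G: "G \<in> carrier_mat m m" and b: "b \<in> carrier_vec m" and i: "i < m"
  shows "((- strict_upper_part G - diag_part G - \<phi> \<cdot>\<^sub>m mat_diag m f) *\<^sub>v b) $ i =
    - (\<Sum>j = i..<m. b $ j * G $$ (i, j)) - \<phi> * f i * b $ i"
proof -
  have "((- strict_upper_part G - diag_part G - \<phi> \<cdot>\<^sub>m mat_diag m f) *\<^sub>v b) $ i =
      (\<Sum>j = 0..<m. - (if i \<le> j then b $ j * G $$ (i, j) else 0) - (if j = i then \<phi> * f i * b $ i else 0))"
    using assms by (auto simp: scalar_prod_def strict_upper_part_def diag_part_def mat_diag_def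
        algebra_simps intro!: sum.cong)
  also have "\<dots> = - (\<Sum>j = 0..<m. if i \<le> j then b $ j * G $$ (i, j) else 0) - \<phi> * f i * b $ i"
    using i by (simp add: sum_subtractf sum_negf)
  also have "(\<Sum>j = 0..<m. if i \<le> j then b $ j * G $$ (i, j) else 0) = (\<Sum>j = i..<m. b $ j * G $$ (i, j))"
    by (intro sum.mono_neutral_cong_right) auto
  finally show ?thesis .
qed

lemma transposed_upper_part_mult_vec:
  assumes G: "G \<in> carrier_mat m m" and a: "a \<in> carrier_vec m" and i: "i < m"
  shows "((- (strict_upper_part G)\<^sup>T - diag_part G - \<phi> \<cdot>\<^sub>m mat_diag m f) *\<^sub>v a) $ i =
    - (\<Sum>j < Suc i. a $ j * G $$ (j, i)) - \<phi> * f i * a $ i"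
proof -
  have "((- (strict_upper_part G)\<^sup>T - diag_part G - \<phi> \<cdot>\<^sub>m mat_diag m f) *\<^sub>v a) $ i =
      (\<Sum>j = 0..<m. - (if j \<le> i then a $ j * G $$ (j, i) else 0) - (if j = i then \<phi> * f i * a $ i else 0))"
    using assms by (auto simp: scalar_prod_def strict_upper_part_def diag_part_def mat_diag_def
        algebra_simps intro!: sum.cong)
  also have "\<dots> = - (\<Sum>j = 0..<m. if j \<le> i then a $ j * G $$ (j, i) else 0) - \<phi> * f i * a $ i"
    using i by (simp add: sum_subtractf sum_negf)
  also have "(\<Sum>j = 0..<m. if j \<le> i then a $ j * G $$ (j, i) else 0) = (\<Sum>j < Suc i. a $ j * G $$ (j, i))"
    using i by (intro sum.mono_neutral_cong_right) auto
  finally show ?thesis .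
qed

lemma diag_mult_vec:
  fixes f :: "nat \<Rightarrow> real"
  assumes "a \<in> carrier_vec m" and "i < m"
  shows "(- (c \<cdot>\<^sub>m mat_diag m f) *\<^sub>v a) $ i = - c * f i * a $ i"
proof -
  have "(- (c \<cdot>\<^sub>m mat_diag m f) *\<^sub>v a) $ i = (\<Sum>j = 0..<m. if j = i then - c * f i * a $ i else 0)"
    using assms by (auto simp: scalar_prod_def mat_diag_def simp flip: sum_negf
        simp del: sum.delta sum.delta' intro!: sum.cong)
  then show ?thesis using assms by simp
qed

lemma append_vec_second:
  assumes "p \<in> carrier_vec m" "i < dim_vec q"
  shows "(p @\<^sub>v q) $ (m + i) = q $ i"
  using assms by auto

lemma append_columns_mult_vec:
  assumes "A \<in> carrier_mat n p" "C \<in> carrier_mat n q" "a \<in> carrier_vec p" "b \<in> carrier_vec q"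
  shows "append_columns A C *\<^sub>v (a @\<^sub>v b) = A *\<^sub>v a + C *\<^sub>v b"
proof -
  have "append_columns A C *\<^sub>v (a @\<^sub>v b) =
      (A *\<^sub>v a + C *\<^sub>v b) @\<^sub>v (0\<^sub>m 0 p *\<^sub>v a + 0\<^sub>m 0 q *\<^sub>v b)"
    using assms four_block_mat_mult_vec[OF assms(1,2), of "0\<^sub>m 0 p" 0 "0\<^sub>m 0 q" a b]
    by (simp add: append_columns_def)
  also have "\<dots> = A *\<^sub>v a + C *\<^sub>v b" by (rule eq_vecI) (use assms in auto)
  finally show ?thesis .
qed

lemma append_columns_transpose_mult_vec:
  assumes "A \<in> carrier_mat n p" "C \<in> carrier_mat n q" "v \<in> carrier_vec n"
  shows "(append_columns A C)\<^sup>T *\<^sub>v v = (A\<^sup>T *\<^sub>v v) @\<^sub>v (C\<^sup>T *\<^sub>v v)"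
  using assms by (intro eq_vecI)
    (auto simp: append_columns_def scalar_prod_def append_vec_def intro!: sum.cong)

lemma append_columns_carrier:
  assumes "A \<in> carrier_mat n p" "C \<in> carrier_mat n q"
  shows "append_columns A C \<in> carrier_mat n (p + q)"
  using assms by (auto simp: append_columns_def)

lemma diag_block_mult_vec:
  assumes G: "G \<in> carrier_mat m m" and Q: "Q \<in> carrier_mat m m"
    and b: "b \<in> carrier_vec m" and i: "i < m"
  shows "((- diag_part G - \<phi> \<cdot>\<^sub>m mat_diag m f - Q) *\<^sub>v b) $ i =
    - G $$ (i, i) * b $ i - \<phi> * f i * b $ i - (Q *\<^sub>v b) $ i"
proof -
  have "((- diag_part G - \<phi> \<cdot>\<^sub>m mat_diag m f - Q) *\<^sub>v b) $ i =
      (\<Sum>j = 0..<m. (if j = i then - G $$ (i, i) * b $ i - \<phi> * f i * b $ i else 0) - Q $$ (i, j) * b $ j)"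
    using assms by (auto simp: scalar_prod_def diag_part_def mat_diag_def
        algebra_simps intro!: sum.cong)
  also have "\<dots> = - G $$ (i, i) * b $ i - \<phi> * f i * b $ i - (\<Sum>j = 0..<m. Q $$ (i, j) * b $ j)"
    using i by (simp add: sum_subtractf)
  also have "(\<Sum>j = 0..<m. Q $$ (i, j) * b $ j) = (Q *\<^sub>v b) $ i"
    using Q b i by (simp add: scalar_prod_def)
  finally show ?thesis .
qed

lemma columns_upto_carrier: "columns_upto n k z \<in> carrier_mat n (Suc k)"
  unfolding columns_upto_def carrier_mat_def by simp

lemma col_columns_upto:
  assumes "i \<le> k" "z i \<in> carrier_vec n"
  shows "col (columns_upto n k z) i = z i"
  unfolding columns_upto_def using assms by (subst col_mat_of_cols) (auto simp: nth_append)

lemma index_columns_upto: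
  assumes "i \<le> k" "r < n"
  shows "columns_upto n k z $$ (r, i) = z i $ r"
  unfolding columns_upto_def using assms
  by (subst mat_of_cols_index) (auto simp: nth_append less_Suc_eq le_less)

lemma columns_upto_mult_vec:
  assumes "a \<in> carrier_vec (Suc k)"
  shows "columns_upto n k z *\<^sub>v a = vec n (\<lambda>r. \<Sum>j<Suc k. a $ j * z j $ r)"
proof (rule eq_vecI)
  fix r assume "r < dim_vec (vec n (\<lambda>r. \<Sum>j<Suc k. a $ j * z j $ r))"
  then have r: "r < n" by simp
  then have "(columns_upto n k z *\<^sub>v a) $ r = (\<Sum>j = 0..<Suc k. columns_upto n k z $$ (r, j) * a $ j)"
    using assms columns_upto_carrier[of n k z] by (simp add: scalar_prod_def del: sum.op_ivl_Suc)
  also have "\<dots> = (\<Sum>j<Suc k. a $ j * z j $ r)"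
    using r by (intro sum.cong) (auto simp: index_columns_upto)
  finally show "(columns_upto n k z *\<^sub>v a) $ r = vec n (\<lambda>r. \<Sum>j<Suc k. a $ j * z j $ r) $ r"
    using r by simp
qed (use columns_upto_carrier[of n k z] in simp)

lemma scalar_prod_combination:
  fixes w :: "real vec"
  assumes "\<And>j. j \<in> J \<Longrightarrow> z j \<in> carrier_vec n"
  shows "w \<bullet> vec n (\<lambda>r. \<Sum>j\<in>J. c j * z j $ r) = (\<Sum>j\<in>J. c j * (w \<bullet> z j))"
proof -
  have "w \<bullet> vec n (\<lambda>r. \<Sum>j\<in>J. c j * z j $ r) = (\<Sum>r<n. \<Sum>j\<in>J. c j * (w $ r * z j $ r))"
    by (auto simp: scalar_prod_def sum_distrib_left ac_simps lessThan_atLeast0 intro!: sum.cong)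
  also have "\<dots> = (\<Sum>j\<in>J. c j * (w \<bullet> z j))"
    by (subst sum.swap)
      (auto simp: scalar_prod_def sum_distrib_left lessThan_atLeast0 carrier_vecD[OF assms] intro!: sum.cong)
  finally show ?thesis .
qed

section \<open>The compact representation\<close>

context broyden_sequence
begin

abbreviation S where "S \<equiv> columns_upto n k s"
abbreviation Y where "Y \<equiv> columns_upto n k y"
abbreviation H0 where "H0 \<equiv> mat_inv (B 0)"
abbreviation \<Psi> where "\<Psi> \<equiv> append_columns S (H0 * Y)"
abbreviation D where "D \<equiv> diag_part (S\<^sup>T * Y)"
abbreviation R where "R \<equiv> strict_upper_part (S\<^sup>T * Y)"
abbreviation \<Lambda> where "\<Lambda> \<equiv> mat_diag (Suc k) lam"

definition M :: "real mat" where
  "M = four_block_mat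
     (- (\<phi> \<cdot>\<^sub>m \<Lambda>)) (- R - D - \<phi> \<cdot>\<^sub>m \<Lambda>)
     (- (R\<^sup>T) - D - \<phi> \<cdot>\<^sub>m \<Lambda>) (- D - \<phi> \<cdot>\<^sub>m \<Lambda> - Y\<^sup>T * H0 * Y)"

lemma B_carrier: "i \<le> Suc k \<Longrightarrow> B i \<in> carrier_mat n n"
  using pos_def by (simp add: sym_pos_def_def)

lemma H0: "H0 \<in> carrier_mat n n" "B 0 * H0 = 1\<^sub>m n" "H0\<^sup>T = H0"
proof -
  have inv: "H0 \<in> carrier_mat n n" "B 0 * H0 = 1\<^sub>m n" "H0 * B 0 = 1\<^sub>m n"
    using mat_inv_of_trivial_kernel[OF B_carrier] sym_pos_def_kernel[OF pos_def] by simp_all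
  then show "H0 \<in> carrier_mat n n" "B 0 * H0 = 1\<^sub>m n" by simp_all
  have "B 0 * H0\<^sup>T = (H0 * B 0)\<^sup>T"
    using transpose_mult[OF inv(1) B_carrier, of 0] pos_def[of 0] by (simp add: sym_pos_def_def)
  then have "B 0 * H0\<^sup>T = 1\<^sub>m n" using inv by simp
  from mat_inv_eqI[OF B_carrier _ this] inv(1) show "H0\<^sup>T = H0" by simp
qed

lemma S_carrier: "S \<in> carrier_mat n (Suc k)" and Y_carrier: "Y \<in> carrier_mat n (Suc k)"
  by (rule columns_upto_carrier)+

lemma HY_carrier: "H0 * Y \<in> carrier_mat n (Suc k)"
  using H0 Y_carrier by simp

lemma SY_carrier: "S\<^sup>T * Y \<in> carrier_mat (Suc k) (Suc k)"
  using S_carrier Y_carrier by simp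

lemma YHY_carrier: "Y\<^sup>T * H0 * Y \<in> carrier_mat (Suc k) (Suc k)"
  using H0 Y_carrier by simp

lemma index_SY: "i \<le> k \<Longrightarrow> j \<le> k \<Longrightarrow> (S\<^sup>T * Y) $$ (i, j) = s i \<bullet> y j"
  using S_carrier Y_carrier s y by (simp add: col_columns_upto)

lemma M_carrier: "M \<in> carrier_mat (Suc k + Suc k) (Suc k + Suc k)"
  using H0 Y_carrier SY_carrier unfolding M_def by (intro four_block_carrier_mat) auto

lemma \<Psi>_carrier: "\<Psi> \<in> carrier_mat n (Suc k + Suc k)"
  by (rule append_columns_carrier[OF S_carrier HY_carrier])

lemma M_mult_vec:
  assumes a: "a \<in> carrier_vec (Suc k)" and b: "b \<in> carrier_vec (Suc k)"
  shows "M *\<^sub>v (a @\<^sub>v b) =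
    (- (\<phi> \<cdot>\<^sub>m \<Lambda>) *\<^sub>v a + (- R - D - \<phi> \<cdot>\<^sub>m \<Lambda>) *\<^sub>v b) @\<^sub>v
    ((- (R\<^sup>T) - D - \<phi> \<cdot>\<^sub>m \<Lambda>) *\<^sub>v a + (- D - \<phi> \<cdot>\<^sub>m \<Lambda> - Y\<^sup>T * H0 * Y) *\<^sub>v b)"
  unfolding M_def
  by (rule four_block_mat_mult_vec[where ?nr1.0 = "Suc k" and ?nr2.0 = "Suc k", OF _ _ _ _ a b])
    (intro uminus_carrier_mat minus_carrier_mat smult_carrier_mat mat_diag_dim YHY_carrier)+

definition u_seq :: "real vec \<Rightarrow> real vec \<Rightarrow> nat \<Rightarrow> real vec" where
  "u_seq b v i = v + vec n (\<lambda>r. \<Sum>j = i..<Suc k. b $ j * y j $ r)"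

definition x_seq :: "real vec \<Rightarrow> real vec \<Rightarrow> real vec \<Rightarrow> nat \<Rightarrow> real vec" where
  "x_seq a b v i = H0 *\<^sub>v u_seq b v 0 + vec n (\<lambda>r. \<Sum>j<i. a $ j * s j $ r)"

lemma u_seq_carrier: "v \<in> carrier_vec n \<Longrightarrow> u_seq b v i \<in> carrier_vec n"
  by (simp add: u_seq_def)

lemma x_seq_carrier: "v \<in> carrier_vec n \<Longrightarrow> x_seq a b v i \<in> carrier_vec n"
  using H0 u_seq_carrier by (simp add: x_seq_def)

lemma u_seq_last: "v \<in> carrier_vec n \<Longrightarrow> u_seq b v (Suc k) = v"
  by (auto simp: u_seq_def)

lemma u_seq_first:
  assumes "b \<in> carrier_vec (Suc k)"
  shows "u_seq b v 0 = v + Y *\<^sub>v b"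
  using columns_upto_mult_vec[OF assms, of n y] by (simp add: u_seq_def lessThan_atLeast0)

lemma x_seq_last:
  assumes a: "a \<in> carrier_vec (Suc k)" and b: "b \<in> carrier_vec (Suc k)" and v: "v \<in> carrier_vec n"
  shows "x_seq a b v (Suc k) = H0 *\<^sub>v v + \<Psi> *\<^sub>v (a @\<^sub>v b)"
proof -
  have Yb: "Y *\<^sub>v b \<in> carrier_vec n" using mult_mat_vec_carrier[OF Y_carrier b] .
  have Sa: "S *\<^sub>v a \<in> carrier_vec n" using mult_mat_vec_carrier[OF S_carrier a] .
  have reorder: "p + q + r = p + (r + q)"
    if "p \<in> carrier_vec n" "q \<in> carrier_vec n" "r \<in> carrier_vec n" for p q r :: "real vec"
    using that by (intro eq_vecI) auto
  have "x_seq a b v (Suc k) = H0 *\<^sub>v (v + Y *\<^sub>v b) + S *\<^sub>v a"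
    unfolding x_seq_def u_seq_first[OF b] columns_upto_mult_vec[OF a] ..
  also have "\<dots> = H0 *\<^sub>v v + (S *\<^sub>v a + H0 *\<^sub>v (Y *\<^sub>v b))"
    unfolding mult_add_distrib_mat_vec[OF H0(1) v Yb]
    by (rule reorder[OF mult_mat_vec_carrier[OF H0(1) v] mult_mat_vec_carrier[OF H0(1) Yb] Sa])
  also have "\<dots> = H0 *\<^sub>v v + \<Psi> *\<^sub>v (a @\<^sub>v b)"
    using append_columns_mult_vec[OF S_carrier HY_carrier a b] assoc_mult_mat_vec[OF H0(1) Y_carrier b]
    by simp
  finally show ?thesis .
qed

text \<open>
  Both halves of the system are read row by row. In row \<open>i\<close> of the first half the tail sum
  combines with \<open>s\<^sub>i\<^sup>T v\<close> into \<open>s\<^sub>i\<^sup>T u\<^sub>i\<close>. In row \<open>i\<close> of the second half the block \<open>Y\<^sup>T H\<^sub>0 Y\<close>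
  combines with the right-hand side into \<open>y\<^sub>i\<^sup>T H\<^sub>0 u\<^sub>0\<close>, to which the initial sum adds the rest of
  \<open>y\<^sub>i\<^sup>T x\<^sub>i\<close> and the term \<open>a\<^sub>i s\<^sub>i\<^sup>T y\<^sub>i\<close>.
\<close>

lemma chain_of_solution:
  assumes a: "a \<in> carrier_vec (Suc k)" and b: "b \<in> carrier_vec (Suc k)" and v: "v \<in> carrier_vec n"
    and sol: "M *\<^sub>v (a @\<^sub>v b) = \<Psi>\<^sup>T *\<^sub>v v"
  shows "chain (($) a) (($) b) (x_seq a b v) (u_seq b v)"
  unfolding chain_def
proof (intro conjI allI impI)
  show "x_seq a b v i \<in> carrier_vec n" "u_seq b v i \<in> carrier_vec n" for i
    using v by (auto simp: x_seq_carrier u_seq_carrier)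
  have u0: "u_seq b v 0 \<in> carrier_vec n" using u_seq_carrier[OF v] .
  have "x_seq a b v 0 = H0 *\<^sub>v u_seq b v 0"
    using H0 by (intro eq_vecI) (auto simp: x_seq_def)
  then show "B 0 *\<^sub>v x_seq a b v 0 = u_seq b v 0"
    using assoc_mult_mat_vec[OF B_carrier H0(1) u0, of 0] H0(2) u0 by simp
  fix i assume i: "i \<le> k"
  then have i': "i < Suc k" by simp
  show "x_seq a b v (Suc i) = x_seq a b v i + a $ i \<cdot>\<^sub>v s i"
    using s[OF i] H0 by (intro eq_vecI) (auto simp: x_seq_def)
  show "u_seq b v i = u_seq b v (Suc i) + b $ i \<cdot>\<^sub>v y i"
    using y[OF i] v
    by (intro eq_vecI) (auto simp: u_seq_def sum.atLeast_Suc_lessThan[OF i'] simp del: sum.op_ivl_Suc)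
  have Yb: "Y *\<^sub>v b \<in> carrier_vec n" using mult_mat_vec_carrier[OF Y_carrier b] .
  have M_top: "(M *\<^sub>v (a @\<^sub>v b)) $ i = - \<phi> * lam i * a $ i
      + (- (\<Sum>j = i..<Suc k. b $ j * (S\<^sup>T * Y) $$ (i, j)) - \<phi> * lam i * b $ i)"
    unfolding M_mult_vec[OF a b]
    using i' SY_carrier diag_mult_vec[OF a i'] upper_part_mult_vec[OF SY_carrier b i']
    by (simp add: carrier_matD[OF mat_diag_dim] del: sum.op_ivl_Suc)
  have M_bottom: "(M *\<^sub>v (a @\<^sub>v b)) $ (Suc k + i) =
      (- (\<Sum>j<Suc i. a $ j * (S\<^sup>T * Y) $$ (j, i)) - \<phi> * lam i * a $ i)
      + (- (S\<^sup>T * Y) $$ (i, i) * b $ i - \<phi> * lam i * b $ i - (Y\<^sup>T * H0 * Y *\<^sub>v b) $ i)"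
  proof -
    let ?q\<^sub>1 = "(- (R\<^sup>T) - D - \<phi> \<cdot>\<^sub>m \<Lambda>) *\<^sub>v a"
    let ?q\<^sub>2 = "(- D - \<phi> \<cdot>\<^sub>m \<Lambda> - Y\<^sup>T * H0 * Y) *\<^sub>v b"
    have dim: "i < dim_vec ?q\<^sub>2"
      unfolding dim_mult_mat_vec index_minus_mat carrier_matD[OF YHY_carrier] by (rule i')
    have "(M *\<^sub>v (a @\<^sub>v b)) $ (Suc k + i) = (?q\<^sub>1 + ?q\<^sub>2) $ i"
      unfolding M_mult_vec[OF a b]
    proof (rule append_vec_second)
      show "- (\<phi> \<cdot>\<^sub>m \<Lambda>) *\<^sub>v a + (- R - D - \<phi> \<cdot>\<^sub>m \<Lambda>) *\<^sub>v b \<in> carrier_vec (Suc k)"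
        by (rule carrier_vecI) (simp only: index_add_vec dim_mult_mat_vec index_minus_mat
            index_smult_mat carrier_matD[OF mat_diag_dim])
      show "i < dim_vec (?q\<^sub>1 + ?q\<^sub>2)" unfolding index_add_vec by (rule dim)
    qed
    also have "\<dots> = ?q\<^sub>1 $ i + ?q\<^sub>2 $ i" by (rule index_add_vec(1)[OF dim])
    finally show ?thesis
      unfolding transposed_upper_part_mult_vec[OF SY_carrier a i']
        diag_block_mult_vec[OF SY_carrier YHY_carrier b i'] .
  qed
  have rhs: "\<Psi>\<^sup>T *\<^sub>v v = (S\<^sup>T *\<^sub>v v) @\<^sub>v ((H0 * Y)\<^sup>T *\<^sub>v v)"
    by (rule append_columns_transpose_mult_vec[OF S_carrier HY_carrier v])
  have rhs_top: "(\<Psi>\<^sup>T *\<^sub>v v) $ i = s i \<bullet> v"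
    unfolding rhs using i s[OF i] S_carrier by (simp add: col_columns_upto)
  have YTw: "(Y\<^sup>T *\<^sub>v w) $ i = y i \<bullet> w" if "w \<in> carrier_vec n" for w
    using that i y[OF i] Y_carrier by (simp add: col_columns_upto)
  have "(H0 * Y)\<^sup>T *\<^sub>v v = Y\<^sup>T *\<^sub>v (H0 *\<^sub>v v)"
    using transpose_mult[OF H0(1) Y_carrier] H0(3)
      assoc_mult_mat_vec[OF _ H0(1) v, of "Y\<^sup>T" "Suc k"] Y_carrier by simp
  then have rhs_bottom: "(\<Psi>\<^sup>T *\<^sub>v v) $ (Suc k + i) = y i \<bullet> (H0 *\<^sub>v v)"
    unfolding rhs using i S_carrier Y_carrier YTw[of "H0 *\<^sub>v v"] mult_mat_vec_carrier[OF H0(1) v]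
    by simp
  have YHYb: "(Y\<^sup>T * H0 * Y *\<^sub>v b) $ i = y i \<bullet> (H0 *\<^sub>v (Y *\<^sub>v b))"
  proof -
    have YT: "Y\<^sup>T \<in> carrier_mat (Suc k) n" using Y_carrier by simp
    have "Y\<^sup>T * H0 * Y *\<^sub>v b = Y\<^sup>T *\<^sub>v (H0 *\<^sub>v (Y *\<^sub>v b))"
      using assoc_mult_mat_vec[OF mult_carrier_mat[OF YT H0(1)] Y_carrier b]
        assoc_mult_mat_vec[OF YT H0(1) Yb] by simp
    then show ?thesis using YTw mult_mat_vec_carrier[OF H0(1) Yb] by simp
  qed
  have top_sum: "(\<Sum>j = i..<Suc k. b $ j * (S\<^sup>T * Y) $$ (i, j)) = (\<Sum>j = i..<Suc k. b $ j * (s i \<bullet> y j))"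
    using i by (intro sum.cong) (auto simp: index_SY)
  have "s i \<bullet> u_seq b v i = s i \<bullet> v + (\<Sum>j = i..<Suc k. b $ j * (s i \<bullet> y j))"
    unfolding u_seq_def
    using scalar_prod_add_distrib[OF s[OF i] v, of "vec n (\<lambda>r. \<Sum>j = i..<Suc k. b $ j * y j $ r)"]
      scalar_prod_combination[of "{i..<Suc k}" y n "s i" "($) b"] y by simp
  with M_top rhs_top sol top_sum
  show "s i \<bullet> u_seq b v i = - \<phi> * lam i * (a $ i + b $ i)"
    by (simp add: algebra_simps)
  have bottom_sum: "(\<Sum>j<Suc i. a $ j * (S\<^sup>T * Y) $$ (j, i)) = (\<Sum>j<i. a $ j * (y i \<bullet> s j)) + a $ i * (s i \<bullet> y i)"
    using i s y by (auto simp: index_SY comm_scalar_prod[of "y i" n] intro!: sum.cong)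
  have "y i \<bullet> x_seq a b v i =
      y i \<bullet> (H0 *\<^sub>v v) + y i \<bullet> (H0 *\<^sub>v (Y *\<^sub>v b)) + (\<Sum>j<i. a $ j * (y i \<bullet> s j))"
  proof -
    have Hv: "H0 *\<^sub>v v \<in> carrier_vec n" "H0 *\<^sub>v (Y *\<^sub>v b) \<in> carrier_vec n"
      using mult_mat_vec_carrier[OF H0(1)] v Yb by blast+
    have "y i \<bullet> x_seq a b v i = y i \<bullet> (H0 *\<^sub>v v + H0 *\<^sub>v (Y *\<^sub>v b))
        + y i \<bullet> vec n (\<lambda>r. \<Sum>j<i. a $ j * s j $ r)"
      unfolding x_seq_def u_seq_first[OF b] mult_add_distrib_mat_vec[OF H0(1) v Yb]
      by (rule scalar_prod_add_distrib[OF y[OF i]]) (use Hv in auto)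
    then show ?thesis
      using scalar_prod_add_distrib[OF y[OF i] Hv] scalar_prod_combination[of "{..<i}" s n "y i" "($) a"]
        s i by simp
  qed
  with M_bottom rhs_bottom sol bottom_sum YHYb index_SY[OF i i]
  show "y i \<bullet> x_seq a b v i + a $ i * (s i \<bullet> y i) =
      - \<phi> * lam i * (a $ i + b $ i) - b $ i * (s i \<bullet> y i)"
    by (simp add: algebra_simps)
qed

text \<open>A kernel vector solves the system for \<open>v = 0\<close>, and its path ends in \<open>u (Suc k) = 0\<close>.\<close>

lemma M_trivial_kernel:
  assumes c: "c \<in> carrier_vec (Suc k + Suc k)" and "M *\<^sub>v c = 0\<^sub>v (Suc k + Suc k)"
  shows "c = 0\<^sub>v (Suc k + Suc k)"
proof -
  define a b where "a = vec_first c (Suc k)" and "b = vec_last c (Suc k)"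
  have a: "a \<in> carrier_vec (Suc k)" and b: "b \<in> carrier_vec (Suc k)" by (simp_all add: a_def b_def)
  have ab: "c = a @\<^sub>v b" using c by (simp add: a_def b_def)
  have "\<Psi>\<^sup>T *\<^sub>v 0\<^sub>v n = 0\<^sub>v (Suc k + Suc k)"
    using \<Psi>_carrier by (intro eq_vecI) auto
  then have "chain (($) a) (($) b) (x_seq a b (0\<^sub>v n)) (u_seq b (0\<^sub>v n))"
    using chain_of_solution[OF a b, of "0\<^sub>v n"] assms(2) ab by simp
  from chain_trivial[OF this u_seq_last] have "a $ i = 0 \<and> b $ i = 0" if "i < Suc k" for i
    using that by simp
  then show ?thesis
    unfolding ab using a b by (intro eq_vecI) auto
qed

lemmas M_inverse = mat_inv_of_trivial_kernel[OF M_carrier M_trivial_kernel]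

lemma invertible_M: "invertible_mat M"
  using M_inverse M_carrier unfolding invertible_mat_def inverts_mat_def by auto

text \<open>For each \<open>v\<close> the vector \<open>(a, b) = M\<^sup>-\<^sup>1 \<Psi>\<^sup>T v\<close> solves the system, and the end of its path
  shows that the claimed inverse maps \<open>v\<close> to a preimage of \<open>v\<close> under \<open>B (Suc k)\<close>.\<close>

lemma inverse_update: "mat_inv (B (Suc k)) = H0 + \<Psi> * mat_inv M * \<Psi>\<^sup>T"
proof -
  let ?m = "Suc k + Suc k"
  let ?H = "H0 + \<Psi> * mat_inv M * \<Psi>\<^sup>T"
  have MI: "mat_inv M \<in> carrier_mat ?m ?m" "M * mat_inv M = 1\<^sub>m ?m" by (rule M_inverse; assumption)+
  have PT: "\<Psi>\<^sup>T \<in> carrier_mat ?m n" using \<Psi>_carrier by simp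
  have PM: "\<Psi> * mat_inv M \<in> carrier_mat n ?m" using \<Psi>_carrier MI(1) by (rule mult_carrier_mat)
  have PMP: "\<Psi> * mat_inv M * \<Psi>\<^sup>T \<in> carrier_mat n n" using PM PT by (rule mult_carrier_mat)
  have H: "?H \<in> carrier_mat n n" using PMP by simp
  have Bc: "B (Suc k) \<in> carrier_mat n n" by (rule B_carrier) simp
  have "B (Suc k) * ?H = 1\<^sub>m n"
  proof (rule mat_eq_one_if_fixes_vecs)
    show "B (Suc k) * ?H \<in> carrier_mat n n" using Bc H by (rule mult_carrier_mat)
    fix v :: "real vec" assume v: "v \<in> carrier_vec n"
    define c where "c = mat_inv M *\<^sub>v (\<Psi>\<^sup>T *\<^sub>v v)"
    define a b where "a = vec_first c (Suc k)" and "b = vec_last c (Suc k)"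
    have Pv: "\<Psi>\<^sup>T *\<^sub>v v \<in> carrier_vec ?m" using mult_mat_vec_carrier[OF PT v] .
    have c: "c \<in> carrier_vec ?m" unfolding c_def by (rule mult_mat_vec_carrier[OF MI(1) Pv])
    have a: "a \<in> carrier_vec (Suc k)" and b: "b \<in> carrier_vec (Suc k)" by (simp_all add: a_def b_def)
    have ab: "a @\<^sub>v b = c" using c by (simp add: a_def b_def)
    have "M *\<^sub>v c = \<Psi>\<^sup>T *\<^sub>v v"
      unfolding c_def using assoc_mult_mat_vec[OF M_carrier MI(1) Pv] MI(2) Pv by simp
    then have "chain (($) a) (($) b) (x_seq a b v) (u_seq b v)"
      using chain_of_solution[OF a b v] ab by simp
    from chain_transport[OF this, of "Suc k"]
    have "B (Suc k) *\<^sub>v (H0 *\<^sub>v v + \<Psi> *\<^sub>v c) = v"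
      using x_seq_last[OF a b v] u_seq_last[OF v] ab by simp
    moreover have "?H *\<^sub>v v = H0 *\<^sub>v v + \<Psi> *\<^sub>v c"
      using add_mult_distrib_mat_vec[OF H0(1) PMP v] assoc_mult_mat_vec[OF PM PT v]
        assoc_mult_mat_vec[OF \<Psi>_carrier MI(1) Pv] by (simp add: c_def)
    ultimately show "B (Suc k) * ?H *\<^sub>v v = v"
      using assoc_mult_mat_vec[OF Bc H v] by simp
  qed
  then show ?thesis by (rule mat_inv_eqI[OF Bc H])
qed

end

theorem mainTheorem1:
  fixes n k :: nat and \<phi> :: real
    and B :: "nat \<Rightarrow> real mat" and s y :: "nat \<Rightarrow> real vec"
    and S Y D R \<Lambda> H\<^sub>0 \<Psi> N :: "real mat"
  assumes "0 \<le> \<phi>" and "\<phi> \<le> 1"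
    and "\<And>i. i \<le> k \<Longrightarrow> s i \<in> carrier_vec n"
    and "\<And>i. i \<le> k \<Longrightarrow> y i \<in> carrier_vec n"
    and "\<And>i. i \<le> k \<Longrightarrow> B (Suc i) = broyden_update \<phi> (B i) (s i) (y i)"
    and "\<And>i. i \<le> k \<Longrightarrow> s i \<noteq> 0\<^sub>v n"
    and "\<And>i. i \<le> k \<Longrightarrow> y i \<bullet> s i \<noteq> 0"
    and "\<And>i. i \<le> Suc k \<Longrightarrow> sym_pos_def n (B i)"
  defines "S \<equiv> columns_upto n k s"
    and "Y \<equiv> columns_upto n k y"
    and "D \<equiv> diag_part (S\<^sup>T * Y)"
    and "R \<equiv> strict_upper_part (S\<^sup>T * Y)"
    and "\<Lambda> \<equiv> mat_diag (Suc k) (\<lambda>i. broyden_lambda \<phi> (B i) (s i) (y i))"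
    and "H\<^sub>0 \<equiv> mat_inv (B 0)"
    and "\<Psi> \<equiv> append_columns S (H\<^sub>0 * Y)"
    and "N \<equiv> four_block_mat
           (- (\<phi> \<cdot>\<^sub>m \<Lambda>))            (- R - D - \<phi> \<cdot>\<^sub>m \<Lambda>)
           (- (R\<^sup>T) - D - \<phi> \<cdot>\<^sub>m \<Lambda>)    (- D - \<phi> \<cdot>\<^sub>m \<Lambda> - Y\<^sup>T * H\<^sub>0 * Y)"
  shows "invertible_mat N \<and>
         mat_inv (B (Suc k)) = H\<^sub>0 + \<Psi> * mat_inv N * \<Psi>\<^sup>T"
proof -
  interpret broyden: broyden_sequence n k \<phi> B s y
    by unfold_locales (use assms(1-8) in auto)
  show ?thesis
    using broyden.invertible_M broyden.inverse_update
    unfolding N_def S_def Y_def D_def R_def \<Lambda>_def H\<^sub>0_def \<Psi>_def broyden.M_def by blast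
qed

end
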